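(* Let $G=(V,E)$ be a simple undirected graph, let $S\subseteq\binom{V}{2}$ be a set of terminal pairs, let $H\subseteq G$ be a subgraph, and let $S'=S\cap\binom{V(H)}{2}$. Then: (i) For $e\in E$, $\mathrm{MultC}(G-e,S)=\pi(\mathrm{MultC}(G,S))$, where $\pi:\mathbb{R}^E\to\mathbb{R}^{E\setminus\{e\}}$ is the orthogonal projection. (ii) If $\sum_{e\in E(H)}a_ex_e\geq b$ is valid for $\mathrm{MultC}(H,S')$, then it (viewed as an inequality on $\mathbb{R}^E$ with zero coefficients outside $E(H)$) is also valid for $\mathrm{MultC}(G,S)$. (iii) If $a^{\mathsf T}x\geq b$ is facet-defining for $\mathrm{MultC}(G,S)$ and $\mathrm{supp}(a)\subseteq H$, then $\sum_{e\in E(H)}a_ex_e\geq b$ is facet-defining for $\mathrm{MultC}(H,S')$. (iv) If $a^{\mathsf T}x\geq b$ (with $a\in\mathbb{R}^{E(H)}$) is facet-defining for $\mathrm{MultC}(H,S')$, then $\sum_{e\in E(H)}a_ex_e\geq b$ is facet-defining for $\mathrm{MultC}(G,S)$.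
   Context: Given a graph $G=(V,E)$ and $S\subseteq\binom{V}{2}$, an ($S$-)multicut is a set $\delta\subseteq E$ such that for every $\{s,t\}\in S$ the nodes $s$ and $t$ lie in different components of $G-\delta$. For $F\subseteq E$, $x^F\in\mathbb{R}^E$ is its incidence vector. The multicut dominant is $\mathrm{MultC}(G,S)=\mathrm{conv}\{x^\delta:\delta \text{ an } S\text{-multicut}\}+\mathbb{R}^E_{\geq 0}$ (for a graph whose node set does not contain all nodes of a pair in $S$, only pairs with both nodes present matter). For a valid inequality $a^{\mathsf T}x\geq b$, $\mathrm{supp}(a)$ is the subgraph of $G$ induced by the edge set $\{e:a_e\neq 0\}$. *)

theory Defs
  imports "HOL-Analysis.Analysis" "HOL-Library.Ramsey"
begin

text \<open>
  Nodes are drawn from a finite type, so that all edge sets live in the finite type \<open>'a set\<close>.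
  The set of all unordered pairs of a set \<open>V\<close> is \<open>nsets V 2\<close>.
\<close>

record 'a graph =
  verts :: "'a set"
  edges :: "'a set set"

definition simple_graph :: "'a graph \<Rightarrow> bool" where
  "simple_graph G \<longleftrightarrow> edges G \<subseteq> nsets (verts G) 2"

definition subgraph :: "'a graph \<Rightarrow> 'a graph \<Rightarrow> bool" where
  "subgraph H G \<longleftrightarrow> simple_graph H \<and> verts H \<subseteq> verts G \<and> edges H \<subseteq> edges G"

definition delete_edges :: "'a graph \<Rightarrow> 'a set set \<Rightarrow> 'a graph" where
  "delete_edges G D = G\<lparr>edges := edges G - D\<rparr>"

definition edge_induced :: "'a set set \<Rightarrow> 'a graph" where
  "edge_induced F = \<lparr>verts = \<Union>F, edges = F\<rparr>"

definition component :: "'a graph \<Rightarrow> 'a \<Rightarrow> 'a set" where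
  "component G u = {v \<in> verts G. (u, v) \<in> {(x, y). {x, y} \<in> edges G}\<^sup>*}"

text \<open>Pairs of \<open>S\<close> that are not contained in the node set of \<open>G\<close> impose no condition.\<close>

definition multicut :: "'a graph \<Rightarrow> 'a set set \<Rightarrow> 'a set set \<Rightarrow> bool" where
  "multicut G S D \<longleftrightarrow> D \<subseteq> edges G \<and>
     (\<forall>s\<in>verts G. \<forall>t\<in>verts G. {s, t} \<in> S \<longrightarrow>
        component (delete_edges G D) s \<noteq> component (delete_edges G D) t)"

text \<open>
  The space of real vectors indexed by an edge set \<open>F\<close> is represented by the coordinate subspace
  \<open>edge_space F\<close> of \<open>real ^ 'a set\<close>. Extending a vector by zero coefficients to a larger edge set is
  therefore the identity, and \<open>a \<bullet> x\<close> is the sum of \<open>a $ e * x $ e\<close> over \<open>e \<in> F\<close> as soon as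
  \<open>a\<close> or \<open>x\<close> lies in \<open>edge_space F\<close>.
\<close>

definition edge_space :: "'a::finite set set \<Rightarrow> (real ^ 'a set) set" where
  "edge_space F = {x. \<forall>e. e \<notin> F \<longrightarrow> x $ e = 0}"

text \<open>The orthogonal projection onto \<open>edge_space F\<close>, i.e. restriction to the coordinates in \<open>F\<close>.\<close>

definition edge_proj :: "'a::finite set set \<Rightarrow> real ^ 'a set \<Rightarrow> real ^ 'a set" where
  "edge_proj F x = (\<chi> e. if e \<in> F then x $ e else 0)"

definition incidence_vector :: "'a::finite set set \<Rightarrow> real ^ 'a set" where
  "incidence_vector F = (\<chi> e. if e \<in> F then 1 else 0)"

definition MultC :: "'a::finite graph \<Rightarrow> 'a set set \<Rightarrow> (real ^ 'a set) set" where
  "MultC G S = convex hull {incidence_vector D | D. multicut G S D}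
     + {x \<in> edge_space (edges G). \<forall>e. 0 \<le> x $ e}"

definition supp :: "real ^ ('a::finite) set \<Rightarrow> 'a graph" where
  "supp a = edge_induced {e. a $ e \<noteq> 0}"

definition valid_ineq :: "'v::euclidean_space set \<Rightarrow> 'v \<Rightarrow> real \<Rightarrow> bool" where
  "valid_ineq P a b \<longleftrightarrow> (\<forall>x\<in>P. a \<bullet> x \<ge> b)"

text \<open>As in \<^const>\<open>facet_of\<close>, a facet is nonempty and has affine dimension one less than \<open>P\<close>.\<close>

definition facet_defining :: "'v::euclidean_space set \<Rightarrow> 'v \<Rightarrow> real \<Rightarrow> bool" where
  "facet_defining P a b \<longleftrightarrow> valid_ineq P a b \<and> {x \<in> P. a \<bullet> x = b} facet_of P"

end

theory Submission imports Defs begin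

text \<open>
  For a subgraph \<open>H\<close> of \<open>G\<close>, intersecting with \<open>edges H\<close> maps the multicuts of \<open>G\<close> onto those
  of \<open>H\<close>, because adding all edges outside \<open>H\<close> to a multicut of \<open>H\<close> yields a multicut of \<open>G\<close>.
  Hence \<open>MultC H S'\<close> is the orthogonal projection of \<open>MultC G S\<close>, which gives (i) and (ii).
  For (iii) and (iv), let \<open>a\<close> be supported on \<open>H\<close>. Both \<open>MultC G S\<close> and its face cut out by
  \<open>a \<bullet> x = b\<close> are closed under adding nonnegative vectors in the projected-out coordinates, so under
  the projection both lose the same affine dimension, namely the number of these coordinates.
  Therefore the face is a facet upstairs iff its projection is a facet downstairs.
\<close>

section \<open>Coordinate subspaces and projections\<close>

lemma linear_edge_proj: "linear (edge_proj F)"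
  by (rule linearI) (auto simp: edge_proj_def vec_eq_iff)

lemma edge_proj_in_edge_space: "edge_proj F x \<in> edge_space F"
  by (auto simp: edge_proj_def edge_space_def)

lemma edge_proj_eq_self_iff: "edge_proj F x = x \<longleftrightarrow> x \<in> edge_space F"
  by (auto simp: edge_proj_def edge_space_def vec_eq_iff)

lemma subspace_edge_space: "subspace (edge_space F)"
  by (auto simp: subspace_def edge_space_def)

lemma inner_edge_proj:
  assumes "a \<in> edge_space F"
  shows "a \<bullet> edge_proj F x = a \<bullet> x"
  unfolding inner_vec_def using assms
  by (intro sum.cong) (auto simp: edge_proj_def edge_space_def)

lemma edge_proj_incidence_vector:
  "edge_proj F (incidence_vector D) = incidence_vector (D \<inter> F)"
  by (auto simp: edge_proj_def incidence_vector_def vec_eq_iff)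

lemma edge_proj_nonneg_orthant:
  assumes "F \<subseteq> E"
  shows "edge_proj F ` {x \<in> edge_space E. \<forall>e. 0 \<le> x $ e} = {x \<in> edge_space F. \<forall>e. 0 \<le> x $ e}"
proof (intro equalityI subsetI)
  fix x assume "x \<in> {x \<in> edge_space F. \<forall>e. 0 \<le> x $ e}"
  moreover from this have "edge_proj F x = x"
    by (simp add: edge_proj_eq_self_iff)
  moreover have "edge_space F \<subseteq> edge_space E"
    using assms by (auto simp: edge_space_def)
  ultimately show "x \<in> edge_proj F ` {x \<in> edge_space E. \<forall>e. 0 \<le> x $ e}"
    by (auto intro!: image_eqI[of _ _ x])
qed (auto simp: edge_proj_def edge_space_def)

lemma linear_image_set_plus:
  assumes "linear f"
  shows "f ` (A + B) = f ` A + f ` B"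
  by (force simp: set_plus_def linear_add[OF assms])

section \<open>Multicuts under passage between a graph and a subgraph\<close>

lemma simple_graphD:
  assumes "simple_graph G" "{u, v} \<in> edges G"
  shows "u \<in> verts G \<and> v \<in> verts G"
proof -
  have "{u, v} \<in> nsets (verts G) 2"
    using assms unfolding simple_graph_def by (rule subsetD)
  then show ?thesis
    by simp
qed

text \<open>Undirected adjacency is symmetric, so reachability is an equivalence relation;
  conversely, \<open>v\<close> lies in its own component by reflexivity.\<close>

lemma component_eq_iff:
  assumes "u \<in> verts G" "v \<in> verts G"
  shows "component G u = component G v \<longleftrightarrow> (u, v) \<in> {(x, y). {x, y} \<in> edges G}\<^sup>*"
proof
  let ?R = "{(x, y). {x, y} \<in> edges G}"
  have "sym ?R"
    by (auto simp: sym_def insert_commute)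
  then have "sym (?R\<^sup>*)"
    by (rule sym_rtrancl)
  then show "component G u = component G v" if "(u, v) \<in> ?R\<^sup>*"
    using that unfolding component_def by (blast intro: rtrancl_trans dest: symD)
  show "(u, v) \<in> ?R\<^sup>*" if "component G u = component G v"
    using that assms unfolding component_def by blast
qed

text \<open>Reachability depends on the edges alone, so multicuts of \<open>G\<close> and
  \<open>H\<close> can be compared without their differing node sets.\<close>

lemma multicut_iff:
  "multicut G S D \<longleftrightarrow> D \<subseteq> edges G \<and>
     (\<forall>s\<in>verts G. \<forall>t\<in>verts G. {s, t} \<in> S \<longrightarrow> (s, t) \<notin> {(x, y). {x, y} \<in> edges G - D}\<^sup>*)"
proof -
  have "component (delete_edges G D) s = component (delete_edges G D) t \<longleftrightarrow>
      (s, t) \<in> {(x, y). {x, y} \<in> edges G - D}\<^sup>*" if "s \<in> verts G" "t \<in> verts G" for s t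
    using component_eq_iff[of s "delete_edges G D" t] that by (simp add: delete_edges_def)
  then show ?thesis
    unfolding multicut_def by blast
qed

text \<open>Every path of \<open>H\<close> avoiding \<open>D\<close> is a path of \<open>G\<close>
  avoiding \<open>D\<close>.\<close>

lemma multicut_subgraph:
  assumes "subgraph H G" "multicut G S D"
  shows "multicut H (S \<inter> nsets (verts H) 2) (D \<inter> edges H)"
proof -
  have "{(x, y). {x, y} \<in> edges H - D \<inter> edges H}\<^sup>* \<subseteq> {(x, y). {x, y} \<in> edges G - D}\<^sup>*"
    using assms(1) by (intro rtrancl_mono) (auto simp: subgraph_def)
  then show ?thesis
    using assms unfolding multicut_iff subgraph_def by blast
qed

lemma multicut_supergraph:
  assumes "S \<subseteq> nsets (verts G) 2" "subgraph H G"
    and "multicut H (S \<inter> nsets (verts H) 2) D"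
  shows "multicut G S (D \<union> (edges G - edges H))"
  unfolding multicut_iff
proof (intro conjI ballI impI)
  show "D \<union> (edges G - edges H) \<subseteq> edges G"
    using assms(2,3) by (auto simp: multicut_def subgraph_def)
next
  fix s t assume st: "{s, t} \<in> S"
  have "edges H \<subseteq> edges G" and H: "simple_graph H"
    using assms(2) by (auto simp: subgraph_def)
  then have R: "edges G - (D \<union> (edges G - edges H)) = edges H - D"
    by blast
  let ?R = "{(x, y). {x, y} \<in> edges H - D}"
  show "(s, t) \<notin> {(x, y). {x, y} \<in> edges G - (D \<union> (edges G - edges H))}\<^sup>*"
    unfolding R
  proof
    assume path: "(s, t) \<in> ?R\<^sup>*"
    \<comment> \<open>Pairs in \<open>S\<close> have two distinct elements, so the path has a first
      and a last edge. Both are edges of \<open>H\<close>, which forces \<open>s\<close> and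
      \<open>t\<close> into \<open>verts H\<close>.\<close>
    have "s \<noteq> t"
      using subsetD[OF assms(1) st] by simp
    with path have trancl: "(s, t) \<in> ?R\<^sup>+"
      by (simp add: rtrancl_eq_or_trancl)
    have "s \<in> verts H" "t \<in> verts H"
      using tranclD[OF trancl] tranclD2[OF trancl] simple_graphD[OF H] by auto
    then show False
      using path st \<open>s \<noteq> t\<close> assms(3) by (auto simp: multicut_iff)
  qed
qed

section \<open>The multicut dominant: projection, convexity and closure upwards\<close>

lemma MultC_subgraph:
  assumes "S \<subseteq> nsets (verts G) 2" "subgraph H G"
  shows "MultC H (S \<inter> nsets (verts H) 2) = edge_proj (edges H) ` MultC G S"
proof -
  let ?p = "edge_proj (edges H)" and ?S' = "S \<inter> nsets (verts H) 2"
  have "?p ` {incidence_vector D |D. multicut G S D} = {incidence_vector D |D. multicut H ?S' D}"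
  proof (intro equalityI subsetI)
    fix x assume "x \<in> ?p ` {incidence_vector D |D. multicut G S D}"
    then show "x \<in> {incidence_vector D |D. multicut H ?S' D}"
      using multicut_subgraph[OF assms(2)] by (auto simp: edge_proj_incidence_vector)
  next
    fix x assume "x \<in> {incidence_vector D |D. multicut H ?S' D}"
    then obtain D where x: "x = incidence_vector D" and D: "multicut H ?S' D"
      by blast
    \<comment> \<open>The preimage adds all edges outside \<open>H\<close>; restriction recovers
      \<open>D\<close> because \<open>D\<close> \<subseteq> \<open>edges H\<close>.\<close>
    have "D = (D \<union> (edges G - edges H)) \<inter> edges H"
      using D by (auto simp: multicut_def)
    then have "x = ?p (incidence_vector (D \<union> (edges G - edges H)))"
      by (simp add: x edge_proj_incidence_vector)
    then show "x \<in> ?p ` {incidence_vector D |D. multicut G S D}"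
      using multicut_supergraph[OF assms D] by blast
  qed
  moreover have "edges H \<subseteq> edges G"
    using assms(2) by (simp add: subgraph_def)
  \<comment> \<open>A linear map commutes with convex hulls and Minkowski sums, and this projection
    sends the nonnegative orthant onto the smaller one.\<close>
  ultimately show ?thesis
    unfolding MultC_def
    by (simp add: linear_image_set_plus linear_edge_proj edge_proj_nonneg_orthant
        convex_hull_linear_image)
qed

lemma convex_MultC: "convex (MultC G S)"
  unfolding MultC_def
  by (intro convex_set_plus convex_convex_hull)
     (auto simp: convex_def edge_space_def)

lemma MultC_subset_edge_space: "MultC G S \<subseteq> edge_space (edges G)"
proof -
  have "convex hull {incidence_vector D | D. multicut G S D} \<subseteq> edge_space (edges G)"
    by (intro hull_minimal subspace_imp_convex subspace_edge_space)
       (auto simp: edge_space_def incidence_vector_def multicut_def)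
  then show ?thesis
    unfolding MultC_def set_plus_def
    using subspace_add[OF subspace_edge_space] by blast
qed

lemma MultC_add_nonneg:
  assumes "x \<in> MultC G S" "z \<in> edge_space (edges G)" "\<And>e. 0 \<le> z $ e"
  shows "x + z \<in> MultC G S"
proof -
  obtain c w where "x = c + w" and c: "c \<in> convex hull {incidence_vector D | D. multicut G S D}"
    and w: "w \<in> edge_space (edges G)" "\<And>e. 0 \<le> w $ e"
    using assms(1) unfolding MultC_def set_plus_def by blast
  then have "x + z = c + (w + z)"
    by simp
  moreover have "w + z \<in> edge_space (edges G)" "\<And>e. 0 \<le> (w + z) $ e"
    using w assms(2,3) subspace_add[OF subspace_edge_space] by auto
  ultimately show ?thesis
    unfolding MultC_def using c by (simp only:) (rule set_plus_intro, auto)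
qed

text \<open>
  The linear span of \<open>A - x\<^sub>0\<close> contains all of \<open>edge_space (E - F)\<close>, so it splits as the direct sum
  of that space and its own projection.
\<close>

lemma aff_dim_edge_proj:
  fixes A :: "(real ^ 'a::finite set) set"
  assumes "F \<subseteq> E" "A \<noteq> {}" "A \<subseteq> edge_space E"
    and closed: "\<And>x z. x \<in> A \<Longrightarrow> z \<in> edge_space (E - F) \<Longrightarrow> (\<And>e. 0 \<le> z $ e) \<Longrightarrow> x + z \<in> A"
  shows "aff_dim A = aff_dim (edge_proj F ` A) + int (dim (edge_space (E - F)))"
proof -
  let ?p = "edge_proj F" and ?K = "edge_space (E - F)"
  obtain x0 where x0: "x0 \<in> A"
    using assms(2) by blast
  define U where "U = span ((\<lambda>x. x - x0) ` A)"
  have U_sub: "U \<subseteq> edge_space E"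
    unfolding U_def using assms(3) x0
    by (intro span_minimal subspace_edge_space)
       (auto intro!: subspace_diff[OF subspace_edge_space])
  have K_sub: "?K \<subseteq> U"
  proof
    fix z assume z: "z \<in> ?K"
    \<comment> \<open>Closure of \<open>A\<close> covers nonnegative directions only, so
      \<open>z\<close> is split into its positive and negative parts.\<close>
    define pos where "pos = (\<chi> e. max (z $ e) 0)"
    define neg where "neg = (\<chi> e. max (- z $ e) 0)"
    have "pos \<in> ?K" "neg \<in> ?K" "\<And>e. 0 \<le> pos $ e" "\<And>e. 0 \<le> neg $ e"
      using z by (auto simp: pos_def neg_def edge_space_def)
    then have "x0 + pos \<in> A" "x0 + neg \<in> A"
      by (auto intro!: closed x0)
    then have "pos \<in> U" "neg \<in> U"
      unfolding U_def by (force intro!: span_base)+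
    moreover have "z = pos - neg"
      by (auto simp: pos_def neg_def vec_eq_iff max_def)
    ultimately show "z \<in> U"
      unfolding U_def by (simp add: span_diff)
  qed
  have U_eq: "U = {x + y |x y. x \<in> ?K \<and> y \<in> ?p ` U}"
  proof (intro equalityI subsetI)
    fix u assume u: "u \<in> U"
    have "u - ?p u \<in> ?K"
      using u U_sub by (auto simp: edge_proj_def edge_space_def)
    then show "u \<in> {x + y |x y. x \<in> ?K \<and> y \<in> ?p ` U}"
      using u by (intro CollectI exI[of _ "u - ?p u"] exI[of _ "?p u"]) auto
  next
    fix v assume "v \<in> {x + y |x y. x \<in> ?K \<and> y \<in> ?p ` U}"
    then obtain x u where v: "v = x + ?p u" and x: "x \<in> ?K" and u: "u \<in> U"
      by blast
    have "u - ?p u \<in> ?K"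
      using u U_sub by (auto simp: edge_proj_def edge_space_def)
    \<comment> \<open>This vector is \<open>?p u\<close>: since \<open>U\<close> contains
      \<open>?K\<close>, it is closed under the projection.\<close>
    then have "u - (u - ?p u) \<in> U"
      using u K_sub unfolding U_def by (blast intro: span_diff)
    then show "v \<in> U"
      using x K_sub unfolding v U_def by (auto intro: span_add)
  qed
  have "subspace (?p ` U)"
    unfolding U_def by (intro linear_subspace_image linear_edge_proj subspace_span)
  then have "dim U + dim (?K \<inter> ?p ` U) = dim ?K + dim (?p ` U)"
    using dim_sums_Int[OF subspace_edge_space] by (subst U_eq) blast
  moreover have "?K \<inter> ?p ` U \<subseteq> {0}"
    by (force simp: edge_proj_def edge_space_def vec_eq_iff)
  then have "dim (?K \<inter> ?p ` U) = 0"
    by (simp only: dim_eq_0)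
  moreover have "aff_dim A = int (dim U)"
    using aff_dim_eq_dim_subtract[OF hull_inc[OF x0]] by (simp add: U_def)
  moreover have "aff_dim (?p ` A) = int (dim (?p ` U))"
  proof -
    \<comment> \<open>Linear maps commute with spans, so \<open>?p\<close>
      U\<open>is the direction space of the affine hull of\<close>?p \<open>A\<close>.\<close>
    have "?p ` U = span ((\<lambda>y. y - ?p x0) ` ?p ` A)"
      unfolding U_def
      by (simp add: linear_span_image[OF linear_edge_proj, symmetric] image_image
          linear_diff[OF linear_edge_proj])
    then show ?thesis
      using aff_dim_eq_dim_subtract[OF hull_inc[OF imageI[OF x0]]] by simp
  qed
  ultimately show ?thesis
    by simp
qed

lemma facet_defining_iff:
  assumes "convex P"
  shows "facet_defining P a b \<longleftrightarrow> valid_ineq P a b \<and> {x \<in> P. a \<bullet> x = b} \<noteq> {} \<and>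
    aff_dim {x \<in> P. a \<bullet> x = b} = aff_dim P - 1"
proof -
  \<comment> \<open>The hyperplane supports \<open>P\<close>, so the face condition in
    \<open>facet_of\<close> is automatic.\<close>
  have "{x \<in> P. a \<bullet> x = b} face_of P" if "valid_ineq P a b"
    using face_of_Int_supporting_hyperplane_ge[OF assms, of b a] that
    by (auto simp: valid_ineq_def Int_def)
  then show ?thesis
    by (auto simp: facet_defining_def facet_of_def)
qed

lemma valid_ineq_MultC_subgraph:
  assumes "S \<subseteq> nsets (verts G) 2" "subgraph H G" "a \<in> edge_space (edges H)"
  shows "valid_ineq (MultC H (S \<inter> nsets (verts H) 2)) a b \<longleftrightarrow> valid_ineq (MultC G S) a b"
  using assms by (simp add: valid_ineq_def MultC_subgraph inner_edge_proj)

text \<open>The polyhedron and its face both lose exactly \<open>dim ?K\<close> under projection, so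
  their difference in dimension is preserved.\<close>

lemma facet_defining_MultC_subgraph:
  assumes "S \<subseteq> nsets (verts G) 2" "subgraph H G" "a \<in> edge_space (edges H)"
  shows "facet_defining (MultC H (S \<inter> nsets (verts H) 2)) a b \<longleftrightarrow> facet_defining (MultC G S) a b"
proof -
  let ?P = "MultC G S" and ?Q = "MultC H (S \<inter> nsets (verts H) 2)"
  let ?p = "edge_proj (edges H)" and ?K = "edge_space (edges G - edges H)"
  let ?FP = "{x \<in> ?P. a \<bullet> x = b}" and ?FQ = "{x \<in> ?Q. a \<bullet> x = b}"
  have sub: "edges H \<subseteq> edges G"
    using assms(2) by (simp add: subgraph_def)
  have Q: "?Q = ?p ` ?P"
    by (rule MultC_subgraph[OF assms(1,2)])
  have FQ: "?FQ = ?p ` ?FP"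
    unfolding Q using inner_edge_proj[OF assms(3)] by auto
  have P_closed: "x + z \<in> ?P" if "x \<in> ?P" "z \<in> ?K" "\<And>e. 0 \<le> z $ e" for x z
    using that by (intro MultC_add_nonneg) (auto simp: edge_space_def)
  have orth: "a \<bullet> z = 0" if "z \<in> ?K" for z
    unfolding inner_vec_def using assms(3) that
    by (intro sum.neutral ballI) (auto simp: edge_space_def)
  have "aff_dim ?FQ = aff_dim ?Q - 1 \<longleftrightarrow> aff_dim ?FP = aff_dim ?P - 1" if "?FP \<noteq> {}"
  proof -
    have "aff_dim ?P = aff_dim ?Q + int (dim ?K)"
      unfolding Q using that P_closed MultC_subset_edge_space[of G S]
      by (intro aff_dim_edge_proj[OF sub]) auto
    \<comment> \<open>Moving along \<open>?K\<close> stays inside the face because \<open>a\<close>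
      is orthogonal to \<open>?K\<close>.\<close>
    moreover have "aff_dim ?FP = aff_dim ?FQ + int (dim ?K)"
      unfolding FQ using that P_closed orth MultC_subset_edge_space[of G S]
      by (intro aff_dim_edge_proj[OF sub]) (auto simp: inner_add_right)
    ultimately show ?thesis
      by linarith
  qed
  moreover have "?FQ \<noteq> {} \<longleftrightarrow> ?FP \<noteq> {}"
    unfolding FQ by blast
  ultimately show ?thesis
    unfolding facet_defining_iff[OF convex_MultC] valid_ineq_MultC_subgraph[OF assms] by blast
qed

theorem theorem3p7:
  fixes G H :: "'a::finite graph" and S S' :: "'a set set"
  assumes "simple_graph G"
    and "S \<subseteq> nsets (verts G) 2"
    and "subgraph H G"
    and "S' = S \<inter> nsets (verts H) 2"
  shows
    "(\<forall>e\<in>edges G. MultC (delete_edges G {e}) S = edge_proj (edges G - {e}) ` MultC G S)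
     \<and> (\<forall>a\<in>edge_space (edges H). \<forall>b.
          valid_ineq (MultC H S') a b \<longrightarrow> valid_ineq (MultC G S) a b)
     \<and> (\<forall>a\<in>edge_space (edges G). \<forall>b.
          facet_defining (MultC G S) a b \<and> subgraph (supp a) H \<longrightarrow>
          facet_defining (MultC H S') (edge_proj (edges H) a) b)
     \<and> (\<forall>a\<in>edge_space (edges H). \<forall>b.
          facet_defining (MultC H S') a b \<longrightarrow> facet_defining (MultC G S) a b)"
proof (intro conjI ballI allI impI)
  fix e assume "e \<in> edges G"
  have "subgraph (delete_edges G {e}) G"
    using assms(1) by (auto simp: subgraph_def simple_graph_def delete_edges_def)
  moreover have "S \<inter> nsets (verts (delete_edges G {e})) 2 = S"
    using assms(2) by (auto simp: delete_edges_def)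
  ultimately show "MultC (delete_edges G {e}) S = edge_proj (edges G - {e}) ` MultC G S"
    using MultC_subgraph[OF assms(2), of "delete_edges G {e}"] by (simp add: delete_edges_def)
next
  fix a b assume "a \<in> edge_space (edges H)" "valid_ineq (MultC H S') a b"
  then show "valid_ineq (MultC G S) a b"
    using valid_ineq_MultC_subgraph assms by blast
next
  fix a b assume a: "facet_defining (MultC G S) a b \<and> subgraph (supp a) H"
  \<comment> \<open>Every edge with nonzero coefficient lies in \<open>H\<close>, so projecting
    \<open>a\<close> leaves it unchanged.\<close>
  then have "a \<in> edge_space (edges H)"
    by (auto simp: subgraph_def supp_def edge_induced_def edge_space_def)
  then show "facet_defining (MultC H S') (edge_proj (edges H) a) b"
    using a facet_defining_MultC_subgraph assms by (metis edge_proj_eq_self_iff)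
next
  fix a b assume "a \<in> edge_space (edges H)" "facet_defining (MultC H S') a b"
  then show "facet_defining (MultC G S) a b"
    using facet_defining_MultC_subgraph assms by blast
qed

end
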